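(* Fix $\delta>0$. For each $n\ge 1$ let $X$ be a random vector in $\mathbb{R}^n$ which, under the parameter value $m\in\mathbb{R}^n$, has the multivariate normal distribution with mean vector $m$ and identity covariance matrix; write $\mathrm{E}_m$ for expectation under $m$. Let $\mathcal{T}=\mathcal{T}_n$ be the class of all test functions $T$ on $\mathbb{R}^n$ such that $T(\mathbf{P}X)=T(X)$ for every orthogonal $n\times n$ matrix $\mathbf{P}$. Then, as $n\to\infty$, $$\sup\{|\mathrm{E}_m(T)-\mathrm{E}_0(T)| : T\in\mathcal{T},\ m\in\mathbb{R}^n,\ \|m\|\le\delta\}\to 0 .$$
   Context: A test function on $\mathbb{R}^n$ is a measurable function $T:\mathbb{R}^n\to[0,1]$ (the conditional probability of rejection given the data). $\mathrm{E}_m(T)$ means $\mathrm{E}_m(T(X))$. $\|\cdot\|$ is the Euclidean norm. The null hypothesis being tested is $m=0$. *)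

theory Defs
  imports "HOL-Probability.Probability"
begin

(* Vectors of R^n, for n varying inside a statement, are the extensional functions
   nat => real on the index set {..<n}, i.e. the space of this product measure space.
   Its sigma-algebra is the Borel sigma-algebra of R^n. *)
abbreviation Rn :: "nat \<Rightarrow> (nat \<Rightarrow> real) measure" where
  "Rn n \<equiv> Pi\<^sub>M {..<n} (\<lambda>_. borel)"

definition enorm :: "nat \<Rightarrow> (nat \<Rightarrow> real) \<Rightarrow> real" where
  "enorm n x = L2_set x {..<n}"

(* Only the entries P i j with i, j < n are relevant. *)
definition orthogonal_mtx :: "nat \<Rightarrow> (nat \<Rightarrow> nat \<Rightarrow> real) \<Rightarrow> bool" where
  "orthogonal_mtx n P \<longleftrightarrow>
     (\<forall>i<n. \<forall>j<n. (\<Sum>k<n. P k i * P k j) = (if i = j then 1 else 0)) \<and>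
     (\<forall>i<n. \<forall>j<n. (\<Sum>k<n. P i k * P j k) = (if i = j then 1 else 0))"

definition mtx_vec :: "nat \<Rightarrow> (nat \<Rightarrow> nat \<Rightarrow> real) \<Rightarrow> (nat \<Rightarrow> real) \<Rightarrow> (nat \<Rightarrow> real)" where
  "mtx_vec n P x = (\<lambda>i\<in>{..<n}. \<Sum>j<n. P i j * x j)"

(* The law N(m, I): the Lebesgue density
   det(2 pi Sigma)^(-1/2) exp(-(x - m)' Sigma^(-1) (x - m) / 2) at Sigma = I. *)
definition mvn :: "nat \<Rightarrow> (nat \<Rightarrow> real) \<Rightarrow> (nat \<Rightarrow> real) measure" where
  "mvn n m = density (Pi\<^sub>M {..<n} (\<lambda>_. lborel))
     (\<lambda>x. ennreal ((2 * pi) powr (- real n / 2) * exp (- (enorm n (\<lambda>i. x i - m i))\<^sup>2 / 2)))"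

definition Expect :: "nat \<Rightarrow> (nat \<Rightarrow> real) \<Rightarrow> ((nat \<Rightarrow> real) \<Rightarrow> real) \<Rightarrow> real" where
  "Expect n m T = (\<integral>x. T x \<partial>mvn n m)"

definition test_functions :: "nat \<Rightarrow> ((nat \<Rightarrow> real) \<Rightarrow> real) set" where
  "test_functions n = {T \<in> borel_measurable (Rn n). \<forall>x\<in>space (Rn n). 0 \<le> T x \<and> T x \<le> 1}"

definition invariant_tests :: "nat \<Rightarrow> ((nat \<Rightarrow> real) \<Rightarrow> real) set" where
  "invariant_tests n = {T \<in> test_functions n.
     \<forall>P. orthogonal_mtx n P \<longrightarrow> (\<forall>x\<in>space (Rn n). T (mtx_vec n P x) = T x)}"

abbreviation (input) power_deviations :: "nat \<Rightarrow> real \<Rightarrow> real set" where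
  "power_deviations n \<delta> \<equiv> {\<bar>Expect n m T - Expect n (\<lambda>i\<in>{..<n}. 0) T\<bar> | T m.
     T \<in> invariant_tests n \<and> m \<in> space (Rn n) \<and> enorm n m \<le> \<delta>}"

lemma sets_mvn [measurable_cong, simp]: "sets (mvn n m) = sets (Rn n)"
  unfolding mvn_def by (simp, rule sets_PiM_cong) simp_all

lemma space_mvn [simp]: "space (mvn n m) = space (Rn n)"
  using sets_mvn by (rule sets_eq_imp_space_eq)

lemma mvn_density_prod:
  "(2 * pi) powr (- real n / 2) * exp (- (enorm n (\<lambda>i. x i - m i))\<^sup>2 / 2)
     = (\<Prod>i<n. normal_density (m i) 1 (x i))"
proof -
  have "(2 * pi) powr (- real n / 2) = ((2 * pi) powr (- (1/2))) powr real n"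
    by (simp add: powr_powr)
  also have "\<dots> = (1 / sqrt (2 * pi)) ^ n"
    by (subst powr_realpow) (simp_all add: powr_minus powr_half_sqrt divide_simps)
  finally have a: "(2 * pi) powr (- real n / 2) = (1 / sqrt (2 * pi)) ^ n" .
  have "exp (- (enorm n (\<lambda>i. x i - m i))\<^sup>2 / 2) = exp (\<Sum>i<n. - (x i - m i)\<^sup>2 / 2)"
    by (simp add: enorm_def L2_set_def sum_nonneg sum_negf sum_divide_distrib)
  also have "\<dots> = (\<Prod>i<n. exp (- (x i - m i)\<^sup>2 / 2))"
    by (simp add: exp_sum)
  finally show ?thesis
    unfolding a normal_density_def by (simp add: prod.distrib prod_dividef power_one_over)
qed

lemma mvn_eq_PiM: "mvn n m = Pi\<^sub>M {..<n} (\<lambda>i. density lborel (normal_density (m i) 1))"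
proof -
  interpret N: product_sigma_finite "\<lambda>i. density lborel (normal_density (m i) 1)"
    by (intro product_sigma_finite.intro prob_space_imp_sigma_finite prob_space_normal_density) simp
  interpret L: product_sigma_finite "\<lambda>_::nat. lborel :: real measure"
    by standard
  show ?thesis
  proof (rule N.PiM_eqI)
    show "sets (mvn n m) = sets (Pi\<^sub>M {..<n} (\<lambda>i. density lborel (normal_density (m i) 1)))"
      unfolding sets_mvn by (rule sets_PiM_cong) simp_all
  next
    fix A assume "\<And>i. i \<in> {..<n} \<Longrightarrow> A i \<in> sets (density lborel (normal_density (m i) 1))"
    then have A: "\<And>i. i < n \<Longrightarrow> A i \<in> sets borel" by simp
    have PA: "Pi\<^sub>E {..<n} A \<in> sets (Pi\<^sub>M {..<n} (\<lambda>_. lborel))"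
      using A by (intro sets_PiM_I_finite) auto
    have "emeasure (mvn n m) (Pi\<^sub>E {..<n} A) =
        (\<integral>\<^sup>+x. ennreal (\<Prod>i<n. normal_density (m i) 1 (x i)) * indicator (Pi\<^sub>E {..<n} A) x
          \<partial>Pi\<^sub>M {..<n} (\<lambda>_. lborel))"
      unfolding mvn_def mvn_density_prod by (rule emeasure_density) (use PA in measurable)
    also have "\<dots> = (\<integral>\<^sup>+x. (\<Prod>i<n. ennreal (normal_density (m i) 1 (x i)) * indicator (A i) (x i))
          \<partial>Pi\<^sub>M {..<n} (\<lambda>_. lborel))"
    proof (rule nn_integral_cong)
      fix x :: "nat \<Rightarrow> real" assume x: "x \<in> space (Pi\<^sub>M {..<n} (\<lambda>_. lborel))"
      have "(indicator (Pi\<^sub>E {..<n} A) x :: ennreal) = (\<Prod>i<n. indicator (A i) (x i))"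
      proof (cases "x \<in> Pi\<^sub>E {..<n} A")
        case True
        then have "\<And>i. i < n \<Longrightarrow> x i \<in> A i" by auto
        then show ?thesis using True by simp
      next
        case False
        then obtain i where "i < n" "x i \<notin> A i"
          using x by (auto simp: space_PiM PiE_iff)
        then have "(\<Prod>i<n. indicator (A i) (x i)) = (0::ennreal)"
          by (intro prod_zero bexI[where x = i]) auto
        then show ?thesis using False by simp
      qed
      then show "ennreal (\<Prod>i<n. normal_density (m i) 1 (x i)) * indicator (Pi\<^sub>E {..<n} A) x
          = (\<Prod>i<n. ennreal (normal_density (m i) 1 (x i)) * indicator (A i) (x i))"
        by (simp add: prod.distrib prod_ennreal)
    qed
    also have "\<dots> = (\<Prod>i<n. \<integral>\<^sup>+y. ennreal (normal_density (m i) 1 y) * indicator (A i) y \<partial>lborel)"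
      by (rule L.product_nn_integral_prod) (use A in auto)
    also have "\<dots> = (\<Prod>i<n. emeasure (density lborel (normal_density (m i) 1)) (A i))"
      using A by (intro prod.cong) (auto simp: emeasure_density)
    finally show "emeasure (mvn n m) (Pi\<^sub>E {..<n} A)
        = (\<Prod>i<n. emeasure (density lborel (normal_density (m i) 1)) (A i))" .
  qed simp
qed

lemma prob_space_mvn: "prob_space (mvn n m)"
  unfolding mvn_eq_PiM by (intro prob_space_PiM prob_space_normal_density) simp

(* power_deviations is nonempty and bounded, so its real Sup is a genuine supremum. *)
lemma power_deviations_nonempty:
  assumes "\<delta> \<ge> 0"
  shows "power_deviations n \<delta> \<noteq> {}"
proof -
  have "(\<lambda>_. 0) \<in> invariant_tests n" "(\<lambda>i\<in>{..<n}. 0) \<in> space (Rn n)"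
    "enorm n (\<lambda>i\<in>{..<n}. 0) \<le> \<delta>"
    using assms
    by (auto simp: invariant_tests_def test_functions_def space_PiM enorm_def L2_set_def)
  then show ?thesis by blast
qed

lemma Expect_bounds:
  assumes "T \<in> test_functions n"
  shows "0 \<le> Expect n m T" "Expect n m T \<le> 1"
proof -
  interpret prob_space "mvn n m" by (rule prob_space_mvn)
  have T: "T \<in> borel_measurable (mvn n m)" "\<And>x. x \<in> space (mvn n m) \<Longrightarrow> 0 \<le> T x \<and> T x \<le> 1"
    using assms by (auto simp: test_functions_def cong: measurable_cong_sets)
  show "0 \<le> Expect n m T"
    unfolding Expect_def using T by (intro integral_nonneg_AE) auto
  have "integrable (mvn n m) T"
    using T by (intro integrable_const_bound[where B = 1]) auto
  then show "Expect n m T \<le> 1"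
    unfolding Expect_def using T by (intro integral_le_const) auto
qed

lemma bdd_above_power_deviations: "bdd_above (power_deviations n \<delta>)"
proof (rule bdd_aboveI[where M = 1])
  fix d assume "d \<in> power_deviations n \<delta>"
  then obtain T m where "T \<in> test_functions n"
    and d: "d = \<bar>Expect n m T - Expect n (\<lambda>i\<in>{..<n}. 0) T\<bar>"
    unfolding invariant_tests_def by blast
  then show "d \<le> 1"
    using Expect_bounds[of T n m] Expect_bounds[of T n "\<lambda>i\<in>{..<n}. 0"] by linarith
qed

end

theory Submission
  imports Defs "HOL-Real_Asymp.Real_Asymp"
begin

text \<open>An invariant test cannot see the direction of the mean, only its length: the test is a function
  of the Euclidean norm (\<open>invariant_test_radial\<close>) and Lebesgue measure is rotation invariant, so
  \<open>Expect n m T\<close> depends on \<open>m\<close> only through \<open>enorm n m\<close> (\<open>Expect_depends_on_enorm\<close>).  The power at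
  \<open>m\<close> is therefore also the average of the powers at any collection of means of the same length.

  Averaging over the \<open>2 ^ n\<close> means \<open>(\<plusminus>a, \<dots>, \<plusminus>a)\<close> with \<open>n a\<^sup>2 = (enorm n m)\<^sup>2\<close> turns the likelihood
  ratio against the null hypothesis into a product \<open>L\<close> over the coordinates, with factors
  \<open>exp (- a\<^sup>2 / 2) * cosh (a * x i)\<close> (\<open>Expect_sign_average\<close>).  Hence the power deviation is
  \<open>E\<^sub>0 (T (L - 1))\<close>, and by Cauchy-Schwarz it is at most
  \<open>sqrt (E\<^sub>0 (L\<^sup>2) - 1) = sqrt (cosh (a\<^sup>2) ^ n - 1)\<close> (\<open>power_deviation_bound\<close>).  For \<open>enorm n m \<le> \<delta>\<close>
  this is at most \<open>sqrt (cosh (\<delta>\<^sup>2 / n) ^ n - 1)\<close>.  Since \<open>cosh u = 1 + O(u\<^sup>2)\<close> near \<open>0\<close>, the \<open>n\<close>-th power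
  is \<open>1 + O(1 / n)\<close> and the bound tends to \<open>0\<close>, uniformly in \<open>T\<close> and \<open>m\<close>.

  Rotations are handled without determinants.  Fubini and translation invariance on the line show
  that a shear changing one coordinate preserves the product Lebesgue measure; a rotation in a
  coordinate plane is a composition of three shears, and such rotations, with one reflection,
  bring every mean onto the nonnegative first axis.\<close>

section \<open>Lebesgue measure under shears and plane rotations\<close>

abbreviation Ln :: "nat \<Rightarrow> (nat \<Rightarrow> real) measure" where
  "Ln n \<equiv> Pi\<^sub>M {..<n} (\<lambda>_. lborel)"

lemma enorm_sq: "(enorm n x)\<^sup>2 = (\<Sum>i<n. (x i)\<^sup>2)"
  by (simp add: enorm_def L2_set_def sum_nonneg)

lemma enorm_nonneg: "0 \<le> enorm n x"
  by (simp add: enorm_def)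

lemma enorm_eqI: "(\<Sum>i<n. (x i)\<^sup>2) = (\<Sum>i<n. (y i)\<^sup>2) \<Longrightarrow> enorm n x = enorm n y"
  by (simp add: enorm_def L2_set_def)

lemma sets_Ln_eq_Rn: "sets (Ln n) = sets (Rn n)"
  by (rule sets_PiM_cong) simp_all

text \<open>Integrate over coordinate \<open>i\<close> first: with the other coordinates fixed, \<open>g\<close> is a constant, and the map
  is a translation of the line, possibly after a reflection.\<close>

lemma nn_integral_coordinate_affine:
  fixes f :: "(nat \<Rightarrow> real) \<Rightarrow> ennreal"
  assumes f: "f \<in> borel_measurable (Ln n)" and g: "g \<in> borel_measurable (Ln n)"
    and i: "i < n" and d: "\<bar>d\<bar> = 1" and indep: "\<And>x y. g (x(i := y)) = g x"
  shows "(\<lambda>x. x(i := d * x i + g x)) \<in> measurable (Ln n) (Ln n)"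
    and "(\<integral>\<^sup>+x. f (x(i := d * x i + g x)) \<partial>Ln n) = (\<integral>\<^sup>+x. f x \<partial>Ln n)"
proof -
  interpret L: product_sigma_finite "\<lambda>_::nat. lborel :: real measure" by standard
  have I: "insert i ({..<n} - {i}) = {..<n}" using i by auto
  have upd: "(\<lambda>(x, y). x(i := y)) \<in> measurable (Ln n \<Otimes>\<^sub>M lborel) (Ln n)"
    using measurable_add_dim[of i "{..<n}" "\<lambda>_. lborel :: real measure"] i
    by (simp add: insert_absorb)
  have ci: "(\<lambda>x. x i) \<in> borel_measurable (Ln n)"
    using measurable_component_singleton[of i "{..<n}" "\<lambda>_. lborel :: real measure"] i by simp
  have "(\<lambda>x. (x, d * x i + g x)) \<in> measurable (Ln n) (Ln n \<Otimes>\<^sub>M lborel)"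
    using ci g by measurable
  from measurable_compose[OF this upd]
  show m: "(\<lambda>x. x(i := d * x i + g x)) \<in> measurable (Ln n) (Ln n)"
    by simp
  have fin: "finite ({..<n} - {i})" "i \<notin> {..<n} - {i}" by auto
  note ins = L.product_nn_integral_insert[OF fin, unfolded I]
  have inner: "(\<integral>\<^sup>+y. f (x(i := d * y + g x)) \<partial>lborel) = (\<integral>\<^sup>+y. f (x(i := y)) \<partial>lborel)"
    if x: "x \<in> space (Pi\<^sub>M ({..<n} - {i}) (\<lambda>_. lborel))" for x :: "nat \<Rightarrow> real"
  proof -
    have "(\<lambda>y. x(i := y)) \<in> measurable lborel (Pi\<^sub>M (insert i ({..<n} - {i})) (\<lambda>_. lborel))"
    proof -
      have "(\<lambda>y. (x, y)) \<in> measurable lborel (Pi\<^sub>M ({..<n} - {i}) (\<lambda>_. lborel) \<Otimes>\<^sub>M lborel)"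
        using x by measurable
      from measurable_compose[OF this measurable_add_dim] show ?thesis by (simp del: insert_Diff_single)
    qed
    then have "(\<lambda>y. f (x(i := y))) \<in> borel_measurable borel"
      using measurable_compose[OF _ f] I by simp
    from nn_integral_real_affine[OF this, of d "g x"]
    show ?thesis using d by (auto simp: add.commute)
  qed
  have "(\<integral>\<^sup>+x. f (x(i := d * x i + g x)) \<partial>Ln n) =
      (\<integral>\<^sup>+x. (\<integral>\<^sup>+y. f (x(i := d * y + g x)) \<partial>lborel) \<partial>Pi\<^sub>M ({..<n} - {i}) (\<lambda>_. lborel))"
    using measurable_compose[OF m f] by (subst ins) (simp_all add: indep)
  also have "\<dots> = (\<integral>\<^sup>+x. (\<integral>\<^sup>+y. f (x(i := y)) \<partial>lborel) \<partial>Pi\<^sub>M ({..<n} - {i}) (\<lambda>_. lborel))"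
    by (rule nn_integral_cong) (rule inner)
  also have "\<dots> = (\<integral>\<^sup>+x. f x \<partial>Ln n)"
    using f by (subst ins) simp_all
  finally show "(\<integral>\<^sup>+x. f (x(i := d * x i + g x)) \<partial>Ln n) = (\<integral>\<^sup>+x. f x \<partial>Ln n)" .
qed

definition preserves_lebesgue :: "nat \<Rightarrow> ((nat \<Rightarrow> real) \<Rightarrow> nat \<Rightarrow> real) \<Rightarrow> bool" where
  "preserves_lebesgue n F \<longleftrightarrow> F \<in> measurable (Ln n) (Ln n) \<and>
     (\<forall>f::(nat \<Rightarrow> real) \<Rightarrow> ennreal. f \<in> borel_measurable (Ln n) \<longrightarrow>
        (\<integral>\<^sup>+x. f (F x) \<partial>Ln n) = (\<integral>\<^sup>+x. f x \<partial>Ln n))"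

lemma nn_integral_preserves_lebesgue:
  fixes f :: "(nat \<Rightarrow> real) \<Rightarrow> ennreal"
  assumes "preserves_lebesgue n F" "f \<in> borel_measurable (Ln n)"
  shows "(\<integral>\<^sup>+x. f (F x) \<partial>Ln n) = (\<integral>\<^sup>+x. f x \<partial>Ln n)"
  using assms unfolding preserves_lebesgue_def by blast

lemma preserves_lebesgue_comp:
  assumes "preserves_lebesgue n F" "preserves_lebesgue n G"
  shows "preserves_lebesgue n (\<lambda>x. F (G x))"
  unfolding preserves_lebesgue_def
proof (intro conjI allI impI)
  have F: "F \<in> measurable (Ln n) (Ln n)" and G: "G \<in> measurable (Ln n) (Ln n)"
    using assms by (auto simp: preserves_lebesgue_def)
  show "(\<lambda>x. F (G x)) \<in> measurable (Ln n) (Ln n)"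
    by (rule measurable_compose[OF G F])
  fix f :: "(nat \<Rightarrow> real) \<Rightarrow> ennreal" assume f: "f \<in> borel_measurable (Ln n)"
  have "(\<integral>\<^sup>+x. f (F (G x)) \<partial>Ln n) = (\<integral>\<^sup>+x. f (F x) \<partial>Ln n)"
    by (rule nn_integral_preserves_lebesgue[OF assms(2) measurable_compose[OF F f]])
  also have "\<dots> = (\<integral>\<^sup>+x. f x \<partial>Ln n)"
    by (rule nn_integral_preserves_lebesgue[OF assms(1) f])
  finally show "(\<integral>\<^sup>+x. f (F (G x)) \<partial>Ln n) = (\<integral>\<^sup>+x. f x \<partial>Ln n)" .
qed

lemma preserves_lebesgue_shear:
  assumes "i < n" "j < n" "i \<noteq> j"
  shows "preserves_lebesgue n (\<lambda>x. x(i := x i + c * x j))"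
proof -
  have "(\<lambda>x. c * x j) \<in> borel_measurable (Ln n)"
    using measurable_component_singleton[of j "{..<n}" "\<lambda>_. lborel :: real measure"] assms
    by simp
  from nn_integral_coordinate_affine[OF _ this, of _ i 1] show ?thesis
    using assms unfolding preserves_lebesgue_def by auto
qed

lemma preserves_lebesgue_flip:
  assumes "i < n"
  shows "preserves_lebesgue n (\<lambda>x. x(i := - x i))"
  using nn_integral_coordinate_affine[of _ n "\<lambda>_. 0" i "-1"] assms
  unfolding preserves_lebesgue_def by auto

definition plane_rotation ::
  "nat \<Rightarrow> nat \<Rightarrow> real \<Rightarrow> real \<Rightarrow> (nat \<Rightarrow> real) \<Rightarrow> nat \<Rightarrow> real" where
  "plane_rotation i j c s x = x(i := c * x i - s * x j, j := s * x i + c * x j)"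

text \<open>With \<open>t = tan (\<theta> / 2) = s / (1 + c)\<close>, the rotation by the angle \<open>\<theta>\<close> with cosine \<open>c\<close> and sine \<open>s\<close>
  subtracts \<open>t\<close> times the second coordinate from the first, adds \<open>s\<close> times the first to the
  second, and repeats the first step.  The half turn \<open>c = -1\<close> is excluded because there
  \<open>tan (\<theta> / 2)\<close> is infinite.\<close>

lemma preserves_lebesgue_plane_rotation:
  assumes "i < n" "j < n" "i \<noteq> j" and cs: "c\<^sup>2 + s\<^sup>2 = 1" and c: "c \<noteq> -1"
  shows "preserves_lebesgue n (plane_rotation i j c s)"
proof -
  define t where "t = s / (1 + c)"
  have c1: "1 + c \<noteq> 0" using c by linarith
  have ts: "t * s = 1 - c"
  proof -
    have "s * s = (1 - c) * (1 + c)" using cs by (simp add: power2_eq_square algebra_simps)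
    then show ?thesis using c1 by (simp add: t_def field_simps)
  qed
  have tc: "t * c = s - t"
    using c1 by (simp add: t_def field_simps)
  note Si = preserves_lebesgue_shear[OF assms(1) assms(2) assms(3), of "-t"]
  note Sj = preserves_lebesgue_shear[OF assms(2) assms(1) assms(3)[symmetric], of s]
  have "plane_rotation i j c s = (\<lambda>x. (\<lambda>x. x(i := x i + (-t) * x j))
      ((\<lambda>x. x(j := x j + s * x i)) ((\<lambda>x. x(i := x i + (-t) * x j)) x)))"
  proof (rule ext)
    fix x :: "nat \<Rightarrow> real"
    have 1: "x j + s * (x i - t * x j) = s * x i + c * x j"
      using arg_cong[OF ts, of "\<lambda>u. u * x j"] by (simp add: algebra_simps)
    have 2: "x i - t * x j - t * (s * x i + c * x j) = c * x i - s * x j"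
      using arg_cong[OF ts, of "\<lambda>u. u * x i"] arg_cong[OF tc, of "\<lambda>u. u * x j"]
      by (simp add: algebra_simps)
    show "plane_rotation i j c s x = (\<lambda>x. x(i := x i + (-t) * x j))
      ((\<lambda>x. x(j := x j + s * x i)) ((\<lambda>x. x(i := x i + (-t) * x j)) x))"
      using 1 2 \<open>i \<noteq> j\<close> by (auto simp: plane_rotation_def fun_eq_iff)
  qed
  then show ?thesis
    using preserves_lebesgue_comp[OF Si preserves_lebesgue_comp[OF Sj Si]] by (simp only:)
qed

lemma enorm_plane_rotation:
  assumes "i < n" "j < n" "i \<noteq> j" and cs: "c\<^sup>2 + s\<^sup>2 = 1"
  shows "enorm n (plane_rotation i j c s x) = enorm n x"
proof (rule enorm_eqI)
  have split: "(\<Sum>k<n. (z k)\<^sup>2) = (z i)\<^sup>2 + ((z j)\<^sup>2 + (\<Sum>k\<in>{..<n} - {i} - {j}. (z k)\<^sup>2))"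
    for z :: "nat \<Rightarrow> real"
    using assms by (simp add: sum.remove[of "{..<n}" i] sum.remove[of "{..<n} - {i}" j])
  have rest: "(\<Sum>k\<in>{..<n} - {i} - {j}. (plane_rotation i j c s x k)\<^sup>2) =
      (\<Sum>k\<in>{..<n} - {i} - {j}. (x k)\<^sup>2)"
    by (intro sum.cong) (auto simp: plane_rotation_def)
  have "(c * x i - s * x j)\<^sup>2 + (s * x i + c * x j)\<^sup>2 = (c\<^sup>2 + s\<^sup>2) * ((x i)\<^sup>2 + (x j)\<^sup>2)"
    by (simp add: power2_eq_square algebra_simps)
  then show "(\<Sum>k<n. (plane_rotation i j c s x k)\<^sup>2) = (\<Sum>k<n. (x k)\<^sup>2)"
    unfolding split[of x] split[of "plane_rotation i j c s x"] rest
    using cs \<open>i \<noteq> j\<close> by (simp add: plane_rotation_def)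
qed

section \<open>Invariant tests depend on the length of the mean only\<close>

text \<open>This matrix is the reflection in the hyperplane orthogonal to \<open>v\<close>.\<close>

lemma householder_orthogonal:
  assumes q: "q = (\<Sum>k<n. (v k)\<^sup>2)" "q \<noteq> 0"
  shows "orthogonal_mtx n (\<lambda>i j. (if i = j then 1 else 0) - 2 * v i * v j / q)"
proof -
  have "(\<Sum>k<n. ((if k = i then 1 else 0) - 2 * v k * v i / q) *
      ((if k = j then 1 else 0) - 2 * v k * v j / q)) = (if i = j then 1 else 0)"
    if "i < n" "j < n" for i j
  proof -
    have "(\<Sum>k<n. ((if k = i then 1 else 0) - 2 * v k * v i / q) *
        ((if k = j then 1 else 0) - 2 * v k * v j / q)) =
      (\<Sum>k<n. (if k = i then (if i = j then 1 else 0) else 0) - (if k = i then 2 * v i * v j / q else 0)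
         - (if k = j then 2 * v i * v j / q else 0) + 4 * v i * v j / q\<^sup>2 * (v k)\<^sup>2)"
      by (rule sum.cong) (auto simp: algebra_simps power2_eq_square)
    also have "\<dots> = (if i = j then 1 else 0) - 2 * v i * v j / q - 2 * v i * v j / q
        + 4 * v i * v j / q\<^sup>2 * q"
      unfolding sum.distrib sum_subtractf sum_distrib_left[symmetric] q(1)[symmetric]
      using that by simp
    also have "\<dots> = (if i = j then 1 else 0)"
      using q(2) by (simp add: power2_eq_square)
    finally show ?thesis .
  qed
  note * = this
  show ?thesis
    unfolding orthogonal_mtx_def
  proof (intro conjI allI impI)
    fix i j assume "i < n" "j < n"
    then show "(\<Sum>k<n. ((if i = k then 1 else 0) - 2 * v i * v k / q) *
      ((if j = k then 1 else 0) - 2 * v j * v k / q)) = (if i = j then 1 else 0)"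
      using *[of i j] by (simp add: mult.commute mult.left_commute eq_commute)
  qed (rule *)
qed

text \<open>Two points of equal norm are exchanged by the reflection in the hyperplane orthogonal to their
  difference.\<close>

lemma invariant_test_radial:
  assumes T: "T \<in> invariant_tests n" and x: "x \<in> space (Rn n)" and y: "y \<in> space (Rn n)"
    and eq: "enorm n x = enorm n y"
  shows "T x = T y"
proof -
  define v where "v = (\<lambda>k. x k - y k)"
  define q where "q = (\<Sum>k<n. (v k)\<^sup>2)"
  have ext: "x k = y k" if "k \<notin> {..<n}" for k
    using x y that by (auto simp: space_PiM PiE_def extensional_def)
  show ?thesis
  proof (cases "q = 0")
    case True
    then have "\<forall>k<n. v k = 0" unfolding q_def by (subst (asm) sum_nonneg_eq_0_iff) auto
    with ext have "x = y" by (auto simp: v_def fun_eq_iff)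
    then show ?thesis by simp
  next
    case False
    define P where "P = (\<lambda>i j. (if i = j then 1 else 0) - 2 * v i * v j / q)"
    have "orthogonal_mtx n P"
      unfolding P_def by (rule householder_orthogonal[OF q_def False])
    moreover have "mtx_vec n P x = y"
    proof -
      have "(\<Sum>k<n. (x k)\<^sup>2) = (\<Sum>k<n. (y k)\<^sup>2)" using eq by (metis enorm_sq)
      (* For points of equal norm, |x - y|^2 = 2 (x - y) . x, so the reflection subtracts
         exactly x - y from x. *)
      moreover have "q = (\<Sum>k<n. 2 * (v k * x k) + ((y k)\<^sup>2 - (x k)\<^sup>2))"
        unfolding q_def v_def by (rule sum.cong) (auto simp: power2_eq_square algebra_simps)
      ultimately have vx: "q = 2 * (\<Sum>k<n. v k * x k)"
        by (simp add: sum.distrib sum_subtractf sum_distrib_left)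
      have "(\<Sum>j<n. P i j * x j) = y i" if "i < n" for i
      proof -
        have "(\<Sum>j<n. P i j * x j) = (\<Sum>j<n. (if j = i then x i else 0) - 2 * v i / q * (v j * x j))"
          unfolding P_def by (rule sum.cong) (auto simp: algebra_simps)
        also have "\<dots> = x i - v i / q * (2 * (\<Sum>k<n. v k * x k))"
          unfolding sum_subtractf sum_distrib_left[symmetric] using that by simp
        also have "\<dots> = y i" unfolding vx[symmetric] using False by (simp add: v_def)
        finally show ?thesis .
      qed
      then show ?thesis using y
        by (auto simp: mtx_vec_def fun_eq_iff space_PiM PiE_def extensional_def)
    qed
    ultimately show ?thesis using T x unfolding invariant_tests_def by force
  qed
qed

lemma invariant_test_properties:
  assumes "T \<in> invariant_tests n"
  shows "T \<in> borel_measurable (Rn n)" "\<And>x. x \<in> space (Rn n) \<Longrightarrow> 0 \<le> T x"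
    "\<And>x. x \<in> space (Rn n) \<Longrightarrow> T x \<le> 1"
  using assms by (auto simp: invariant_tests_def test_functions_def)

lemma Expect_cong:
  assumes "\<And>i. i < n \<Longrightarrow> m i = m' i"
  shows "Expect n m T = Expect n m' T"
proof -
  have "enorm n (\<lambda>i. x i - m i) = enorm n (\<lambda>i. x i - m' i)" for x
    using assms by (intro enorm_eqI sum.cong) auto
  then show ?thesis by (simp add: Expect_def mvn_def)
qed

text \<open>Substituting \<open>F x\<close> for \<open>x\<close> in the integral at mean \<open>F m\<close> changes neither the measure, nor the density
  (which sees only the distance between point and mean), nor the value of the radial function \<open>T\<close>.\<close>

lemma Expect_isometry:
  assumes T: "T \<in> invariant_tests n" and F: "preserves_lebesgue n F"
    and iso: "\<And>x y. enorm n (\<lambda>k. F x k - F y k) = enorm n (\<lambda>k. x k - y k)"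
    and norm: "\<And>x. enorm n (F x) = enorm n x"
  shows "Expect n (F m) T = Expect n m T"
proof -
  note Tp = invariant_test_properties[OF T]
  have TL[measurable]: "T \<in> borel_measurable (Ln n)"
    using Tp(1) by (simp cong: measurable_cong_sets add: measurable_cong_sets[OF sets_Ln_eq_Rn])
  have spL: "space (Ln n) = space (Rn n)" by (rule sets_eq_imp_space_eq[OF sets_Ln_eq_Rn])
  define h where "h = (\<lambda>a x. ennreal ((2 * pi) powr (- real n / 2) *
     exp (- (enorm n (\<lambda>i. x i - a i))\<^sup>2 / 2)))"
  have h[measurable]: "h a \<in> borel_measurable (Ln n)" for a
    unfolding h_def mvn_density_prod by measurable
  have E: "Expect n a T = enn2real (\<integral>\<^sup>+x. h a x * ennreal (T x) \<partial>Ln n)" for a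
  proof -
    have "Expect n a T = enn2real (\<integral>\<^sup>+x. ennreal (T x) \<partial>mvn n a)"
      unfolding Expect_def using Tp
      by (intro integral_eq_nn_integral) (auto cong: measurable_cong_sets)
    also have "(\<integral>\<^sup>+x. ennreal (T x) \<partial>mvn n a) = (\<integral>\<^sup>+x. h a x * ennreal (T x) \<partial>Ln n)"
    proof -
      have "mvn n a = density (Ln n) (h a)" by (simp add: mvn_def h_def)
      then show ?thesis by (simp add: nn_integral_density)
    qed
    finally show ?thesis .
  qed
  have "(\<integral>\<^sup>+x. h (F m) x * ennreal (T x) \<partial>Ln n) =
      (\<integral>\<^sup>+x. h (F m) (F x) * ennreal (T (F x)) \<partial>Ln n)"
    by (rule nn_integral_preserves_lebesgue[OF F, symmetric]) measurable
  also have "\<dots> = (\<integral>\<^sup>+x. h m x * ennreal (T x) \<partial>Ln n)"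
  proof (rule nn_integral_cong)
    fix x assume x: "x \<in> space (Ln n)"
    then have "F x \<in> space (Ln n)"
      using F unfolding preserves_lebesgue_def by (auto dest: measurable_space)
    then have "T (F x) = T x"
      using x spL norm by (intro invariant_test_radial[OF T]) auto
    then show "h (F m) (F x) * ennreal (T (F x)) = h m x * ennreal (T x)"
      by (simp add: h_def iso)
  qed
  finally show ?thesis unfolding E by simp
qed

lemma Expect_plane_rotation:
  assumes "T \<in> invariant_tests n" "i < n" "j < n" "i \<noteq> j" "c\<^sup>2 + s\<^sup>2 = 1" "c \<noteq> -1"
  shows "Expect n (plane_rotation i j c s m) T = Expect n m T"
proof (rule Expect_isometry[where F = "plane_rotation i j c s"])
  fix x y
  have "(\<lambda>k. plane_rotation i j c s x k - plane_rotation i j c s y k) =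
      plane_rotation i j c s (\<lambda>k. x k - y k)"
    by (auto simp: plane_rotation_def fun_eq_iff algebra_simps)
  then show "enorm n (\<lambda>k. plane_rotation i j c s x k - plane_rotation i j c s y k) =
      enorm n (\<lambda>k. x k - y k)"
    using assms by (simp add: enorm_plane_rotation)
qed (rule assms(1) preserves_lebesgue_plane_rotation[OF assms(2-6)]
  enorm_plane_rotation[OF assms(2-5)])+

lemma Expect_flip:
  assumes "T \<in> invariant_tests n" "i < n"
  shows "Expect n (m(i := - m i)) T = Expect n m T"
proof (rule Expect_isometry[where F = "\<lambda>x. x(i := - x i)"])
  fix x y :: "nat \<Rightarrow> real"
  have "((x(i := - x i)) k - (y(i := - y i)) k)\<^sup>2 = (x k - y k)\<^sup>2" for k
    by (simp add: power2_eq_square algebra_simps)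
  then show "enorm n (\<lambda>k. (x(i := - x i)) k - (y(i := - y i)) k) = enorm n (\<lambda>k. x k - y k)"
    by (intro enorm_eqI) (simp only:)
  show "enorm n (x(i := - x i)) = enorm n x"
    by (intro enorm_eqI sum.cong) auto
qed (rule assms(1) preserves_lebesgue_flip[OF assms(2)])+

text \<open>Givens elimination: a rotation in the plane of coordinates \<open>0\<close> and \<open>j\<close> moves the mass of the mean in
  coordinate \<open>j\<close> into coordinate \<open>0\<close>.  \<open>S\<close> holds the coordinates other than \<open>0\<close>
  that may still be nonzero.\<close>

lemma Expect_reduce_to_axis:
  assumes T: "T \<in> invariant_tests n" and n: "0 < n"
    and S: "finite S" "S \<subseteq> {0<..<n}" and supp: "\<And>i. i \<in> {0<..<n} - S \<Longrightarrow> m i = 0"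
  shows "\<exists>a. \<bar>a\<bar> = enorm n m \<and> Expect n m T = Expect n ((\<lambda>_. 0)(0 := a)) T"
  using S supp
proof (induction S arbitrary: m rule: finite_induct)
  case empty
  have "{..<n} = insert 0 {0<..<n}" using n by auto
  then have "(enorm n m)\<^sup>2 = (m 0)\<^sup>2" using empty by (simp add: enorm_sq)
  then have "\<bar>m 0\<bar>\<^sup>2 = (enorm n m)\<^sup>2" by simp
  then have "\<bar>m 0\<bar> = enorm n m"
    by (rule power2_eq_imp_eq) (rule abs_ge_zero enorm_nonneg)+
  moreover have "Expect n m T = Expect n ((\<lambda>_. 0)(0 := m 0)) T"
    by (rule Expect_cong) (use empty in auto)
  ultimately show ?case by blast
next
  case (insert j S)
  then have j: "j < n" "j \<noteq> 0" by auto
  show ?case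
  proof (cases "m j = 0")
    case True
    show ?thesis
    proof (intro insert.IH)
      show "S \<subseteq> {0<..<n}" using insert.prems by simp
      show "m i = 0" if "i \<in> {0<..<n} - S" for i
        using that insert.prems(2)[of i] True by (cases "i = j") auto
    qed
  next
    case False
    define r where "r = sqrt ((m 0)\<^sup>2 + (m j)\<^sup>2)"
    have r: "r > 0" "r\<^sup>2 = (m 0)\<^sup>2 + (m j)\<^sup>2"
      using False by (simp_all add: r_def add_nonneg_pos)
    (* The sign keeps the cosine nonnegative, hence away from -1. *)
    define \<sigma> :: real where "\<sigma> = (if m 0 < 0 then -1 else 1)"
    have \<sigma>: "\<sigma> * m 0 \<ge> 0" "\<sigma>\<^sup>2 = 1" by (auto simp: \<sigma>_def)
    define c where "c = \<sigma> * m 0 / r"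
    define s where "s = - (\<sigma> * m j / r)"
    have c: "c \<noteq> -1"
    proof -
      have "c \<ge> 0" unfolding c_def using \<sigma> r by (intro divide_nonneg_pos)
      then show ?thesis by linarith
    qed
    have cs: "c\<^sup>2 + s\<^sup>2 = 1"
    proof -
      have "c\<^sup>2 + s\<^sup>2 = \<sigma>\<^sup>2 * ((m 0)\<^sup>2 + (m j)\<^sup>2) / r\<^sup>2"
        unfolding c_def s_def power2_minus power_divide power_mult_distrib
        by (simp only: distrib_left add_divide_distrib)
      then show ?thesis using r(1) unfolding \<sigma>(2) r(2)[symmetric] by simp
    qed
    define m' where "m' = plane_rotation 0 j c s m"
    have "m' j = 0" using j by (simp add: m'_def plane_rotation_def c_def s_def)
    have m': "m' i = m i" if "i \<noteq> 0" "i \<noteq> j" for i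
      using that by (simp add: m'_def plane_rotation_def)
    have "\<exists>a. \<bar>a\<bar> = enorm n m' \<and> Expect n m' T = Expect n ((\<lambda>_. 0)(0 := a)) T"
    proof (intro insert.IH)
      show "S \<subseteq> {0<..<n}" using insert.prems by simp
      show "m' i = 0" if "i \<in> {0<..<n} - S" for i
        using that insert.prems(2)[of i] \<open>m' j = 0\<close> m' by (cases "i = j") auto
    qed
    moreover have "enorm n m' = enorm n m"
      unfolding m'_def using j n cs by (intro enorm_plane_rotation) auto
    moreover have "Expect n m' T = Expect n m T"
      unfolding m'_def using j n cs c by (intro Expect_plane_rotation[OF T]) auto
    ultimately show ?thesis by (simp only:)
  qed
qed

lemma Expect_depends_on_enorm:
  assumes T: "T \<in> invariant_tests n" and eq: "enorm n m = enorm n m'"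
  shows "Expect n m T = Expect n m' T"
proof (cases "n = 0")
  case True
  then show ?thesis by (intro Expect_cong) simp
next
  case False
  have "Expect n z T = Expect n ((\<lambda>_. 0)(0 := enorm n z)) T" for z
  proof -
    obtain a where a: "\<bar>a\<bar> = enorm n z" "Expect n z T = Expect n ((\<lambda>_. 0)(0 := a)) T"
      using Expect_reduce_to_axis[OF T, of "{0<..<n}" z] False by auto
    have "Expect n ((\<lambda>_. 0)(0 := -a)) T = Expect n ((\<lambda>_. 0)(0 := a)) T"
      using Expect_flip[OF T, of 0 "(\<lambda>_. 0)(0 := a)"] False by simp
    with a show ?thesis by (metis abs_if)
  qed
  then show ?thesis using eq by metis
qed


section \<open>The likelihood ratio of the sign mixture\<close>

abbreviation std_normal :: "real measure" where
  "std_normal \<equiv> density lborel (normal_density 0 1)"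

lemma normal_density_exp_tilt:
  "normal_density \<mu> 1 x = normal_density 0 1 x * exp (\<mu> * x - \<mu>\<^sup>2 / 2)"
  by (simp add: normal_density_def mult_exp_exp power2_eq_square algebra_simps diff_divide_distrib
      add_divide_distrib)

lemma std_normal_exp:
  shows integrable_std_normal_exp: "integrable std_normal (\<lambda>x. exp (b * x))"
    and integral_std_normal_exp: "(\<integral>x. exp (b * x) \<partial>std_normal) = exp (b\<^sup>2 / 2)"
proof -
  have eq: "normal_density 0 1 x * exp (b * x) = exp (b\<^sup>2 / 2) * normal_density b 1 x" for x
    by (simp add: normal_density_exp_tilt[of b] exp_diff)
  show "integrable std_normal (\<lambda>x. exp (b * x))"
    by (subst integrable_real_density) (simp_all add: eq)
  show "(\<integral>x. exp (b * x) \<partial>std_normal) = exp (b\<^sup>2 / 2)"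
    by (subst integral_real_density) (simp_all add: eq)
qed

text \<open>The likelihood ratio of the even mixture of the normal laws with means \<open>a\<close> and \<open>- a\<close> against the
  standard normal law; see \<open>sign_ratio_average\<close>.\<close>

definition sign_ratio :: "real \<Rightarrow> real \<Rightarrow> real" where
  "sign_ratio a x = exp (- a\<^sup>2 / 2) * cosh (a * x)"

lemma sign_ratio_average:
  "(exp (a * x - a\<^sup>2 / 2) + exp (- a * x - a\<^sup>2 / 2)) / 2 = sign_ratio a x"
proof -
  have "exp (b * x - a\<^sup>2 / 2) = exp (- a\<^sup>2 / 2) * exp (b * x)" for b
    by (simp add: mult_exp_exp)
  from this[of a] this[of "- a"] show ?thesis
    by (simp add: sign_ratio_def cosh_def algebra_simps)
qed

lemma integrable_sign_ratio: "integrable std_normal (sign_ratio a)"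
  and integral_sign_ratio: "(\<integral>x. sign_ratio a x \<partial>std_normal) = 1"
proof -
  have eq: "sign_ratio a = (\<lambda>x. exp (- a\<^sup>2 / 2) / 2 * (exp (a * x) + exp ((- a) * x)))"
    by (simp add: fun_eq_iff sign_ratio_def cosh_def)
  show "integrable std_normal (sign_ratio a)"
    unfolding eq by (intro integrable_mult_right Bochner_Integration.integrable_add integrable_std_normal_exp)
  show "(\<integral>x. sign_ratio a x \<partial>std_normal) = 1"
    unfolding eq integral_mult_right_zero
    by (subst Bochner_Integration.integral_add)
      (simp_all only: integrable_std_normal_exp integral_std_normal_exp,
        simp add: mult_exp_exp)
qed

text \<open>For independent signs \<open>\<epsilon>\<close> and \<open>\<epsilon>'\<close>, the second moment is the mean of \<open>exp (a\<^sup>2 \<epsilon> \<epsilon>')\<close>, which is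
  \<open>cosh (a\<^sup>2)\<close>.  This is what makes the mixture effective: the first-order terms in \<open>a\<^sup>2\<close> cancel.\<close>

lemma integrable_sign_ratio_sq: "integrable std_normal (\<lambda>x. (sign_ratio a x)\<^sup>2)"
  and integral_sign_ratio_sq: "(\<integral>x. (sign_ratio a x)\<^sup>2 \<partial>std_normal) = cosh (a\<^sup>2)"
proof -
  interpret prob_space std_normal by (rule prob_space_normal_density) simp
  have eq: "(sign_ratio a x)\<^sup>2 =
      exp (- a\<^sup>2) / 4 * (exp ((2 * a) * x) + exp ((- 2 * a) * x)) + exp (- a\<^sup>2) / 2" for x
  proof -
    have "(exp (a * x) + exp (- (a * x)))\<^sup>2 = exp ((2 * a) * x) + exp ((- 2 * a) * x) + 2"
      by (simp add: power2_eq_square algebra_simps mult_exp_exp)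
    moreover have "(exp (- a\<^sup>2 / 2))\<^sup>2 = exp (- a\<^sup>2)"
      by (simp add: power2_eq_square mult_exp_exp)
    moreover have "(sign_ratio a x)\<^sup>2 =
        (exp (- a\<^sup>2 / 2))\<^sup>2 * (exp (a * x) + exp (- (a * x)))\<^sup>2 / 4"
      by (simp add: sign_ratio_def cosh_def power_mult_distrib power_divide)
    ultimately show ?thesis by (simp add: algebra_simps)
  qed
  have int: "integrable std_normal (\<lambda>x. exp (- a\<^sup>2) / 4 * (exp ((2 * a) * x) + exp ((- 2 * a) * x)))"
    by (intro integrable_mult_right Bochner_Integration.integrable_add integrable_std_normal_exp)
  show "integrable std_normal (\<lambda>x. (sign_ratio a x)\<^sup>2)"
    unfolding eq using int by (rule Bochner_Integration.integrable_add) simp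
  have "(\<integral>x. (sign_ratio a x)\<^sup>2 \<partial>std_normal) =
      exp (- a\<^sup>2) / 4 * ((\<integral>x. exp ((2 * a) * x) \<partial>std_normal) + (\<integral>x. exp ((- 2 * a) * x) \<partial>std_normal))
        + exp (- a\<^sup>2) / 2"
    unfolding eq using int
    by (subst Bochner_Integration.integral_add)
      (simp_all only: integral_mult_right_zero Bochner_Integration.integral_add
        integrable_std_normal_exp integrable_const lebesgue_integral_const prob_space scaleR_one)
  also have "\<dots> = cosh (a\<^sup>2)"
    by (simp only: integral_std_normal_exp) (simp add: cosh_def mult_exp_exp algebra_simps)
  finally show "(\<integral>x. (sign_ratio a x)\<^sup>2 \<partial>std_normal) = cosh (a\<^sup>2)" .
qed

lemma mvn_prod:
  fixes g :: "nat \<Rightarrow> real \<Rightarrow> real"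
  assumes "\<And>i. i < n \<Longrightarrow> integrable std_normal (g i)"
  shows integrable_mvn_prod: "integrable (mvn n (\<lambda>_. 0)) (\<lambda>x. \<Prod>i<n. g i (x i))"
    and integral_mvn_prod: "(\<integral>x. (\<Prod>i<n. g i (x i)) \<partial>mvn n (\<lambda>_. 0)) = (\<Prod>i<n. \<integral>y. g i y \<partial>std_normal)"
proof -
  interpret product_sigma_finite "\<lambda>_::nat. std_normal"
    by (intro product_sigma_finite.intro prob_space_imp_sigma_finite prob_space_normal_density) simp
  show "integrable (mvn n (\<lambda>_. 0)) (\<lambda>x. \<Prod>i<n. g i (x i))"
    unfolding mvn_eq_PiM using assms by (intro product_integrable_prod) auto
  show "(\<integral>x. (\<Prod>i<n. g i (x i)) \<partial>mvn n (\<lambda>_. 0)) = (\<Prod>i<n. \<integral>y. g i y \<partial>std_normal)"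
    unfolding mvn_eq_PiM using assms by (intro product_integral_prod) auto
qed

lemma integrable_test_mult:
  assumes T: "T \<in> test_functions n" and f: "integrable (mvn n m) f"
  shows "integrable (mvn n m) (\<lambda>x. T x * f x)"
proof (rule Bochner_Integration.integrable_bound[OF f])
  have [measurable]: "T \<in> borel_measurable (mvn n m)"
    using T by (auto simp: test_functions_def cong: measurable_cong_sets)
  show "(\<lambda>x. T x * f x) \<in> borel_measurable (mvn n m)"
    using f by measurable
  show "AE x in mvn n m. norm (T x * f x) \<le> norm (f x)"
    using T by (intro AE_I2) (auto simp: test_functions_def abs_mult intro!: mult_left_le_one_le)
qed

lemma Expect_likelihood_ratio:
  assumes T: "T \<in> test_functions n"
  shows "Expect n m T =
    (\<integral>x. T x * (\<Prod>i<n. exp (m i * x i - (m i)\<^sup>2 / 2)) \<partial>mvn n (\<lambda>_. 0))"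
proof -
  let ?L = "\<lambda>x. \<Prod>i<n. exp (m i * x i - (m i)\<^sup>2 / 2)"
  have L: "?L \<in> borel_measurable (Ln n)" by measurable
  have d: "(\<lambda>x. ennreal (\<Prod>i<n. normal_density 0 1 (x i))) \<in> borel_measurable (Ln n)" by measurable
  have "mvn n m = density (Ln n) (\<lambda>x. ennreal (\<Prod>i<n. normal_density 0 1 (x i)) * ennreal (?L x))"
    unfolding mvn_def mvn_density_prod
    by (subst normal_density_exp_tilt) (simp add: prod.distrib ennreal_mult prod_nonneg)
  also have "\<dots> = density (mvn n (\<lambda>_. 0)) (\<lambda>x. ennreal (?L x))"
    unfolding mvn_def mvn_density_prod using L d by (subst density_density_eq) auto
  finally have eq: "mvn n m = density (mvn n (\<lambda>_. 0)) (\<lambda>x. ennreal (?L x))" .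
  have "T \<in> borel_measurable (mvn n (\<lambda>_. 0))"
    using T by (auto simp: test_functions_def cong: measurable_cong_sets)
  moreover have "?L \<in> borel_measurable (mvn n (\<lambda>_. 0))"
    using L by (simp cong: measurable_cong_sets add: measurable_cong_sets[OF sets_Ln_eq_Rn])
  ultimately show ?thesis
    unfolding Expect_def eq by (subst integral_real_density) (auto simp: prod_nonneg mult.commute)
qed

text \<open>All the means with entries \<open>a\<close> or \<open>- a\<close> have the length of \<open>m\<close> and so the same power.  Their
  likelihood ratios are products over the coordinates, and by distributivity the sum of these products
  over all sign patterns is the product of the two-term sums.\<close>

lemma Expect_sign_average:
  assumes T: "T \<in> invariant_tests n" and m: "(enorm n m)\<^sup>2 = real n * a\<^sup>2"
  shows "Expect n m T = (\<integral>x. T x * (\<Prod>i<n. sign_ratio a (x i)) \<partial>mvn n (\<lambda>_. 0))"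
proof -
  have T': "T \<in> test_functions n" using T by (simp add: invariant_tests_def)
  define sg :: "bool \<Rightarrow> real" where "sg b = (if b then a else - a)" for b
  let ?S = "Pi\<^sub>E {..<n} (\<lambda>_. UNIV :: bool set)"
  let ?L = "\<lambda>\<epsilon> x. \<Prod>i<n. exp (sg (\<epsilon> i) * x i - (sg (\<epsilon> i))\<^sup>2 / 2)"
  have "Expect n m T = (\<integral>x. T x * ?L \<epsilon> x \<partial>mvn n (\<lambda>_. 0))" for \<epsilon>
  proof -
    have "(enorm n (\<lambda>i. sg (\<epsilon> i)))\<^sup>2 = (enorm n m)\<^sup>2"
      unfolding m by (simp add: enorm_sq sg_def if_distrib[of "\<lambda>u. u\<^sup>2"] cong: if_cong)
    then have "enorm n m = enorm n (\<lambda>i. sg (\<epsilon> i))"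
      by (rule power2_eq_imp_eq[OF sym]) (rule enorm_nonneg)+
    from Expect_depends_on_enorm[OF T this] show ?thesis
      by (simp add: Expect_likelihood_ratio[OF T'])
  qed
  note E = this
  have int: "integrable (mvn n (\<lambda>_. 0)) (\<lambda>x. T x * ?L \<epsilon> x)" for \<epsilon>
    by (intro integrable_test_mult[OF T'] integrable_mvn_prod)
      (simp add: exp_diff integrable_std_normal_exp)
  have prod: "(\<Sum>\<epsilon>\<in>?S. ?L \<epsilon> x) = 2 ^ n * (\<Prod>i<n. sign_ratio a (x i))" for x
  proof -
    have "(\<Sum>\<epsilon>\<in>?S. ?L \<epsilon> x) = (\<Prod>i<n. \<Sum>b\<in>UNIV. exp (sg b * x i - (sg b)\<^sup>2 / 2))"
      by (rule prod_sum_PiE[symmetric]) auto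
    also have "\<dots> = (\<Prod>i<n. 2 * sign_ratio a (x i))"
    proof (rule prod.cong[OF refl])
      fix i
      show "(\<Sum>b\<in>UNIV. exp (sg b * x i - (sg b)\<^sup>2 / 2)) = 2 * sign_ratio a (x i)"
        using sign_ratio_average[of a "x i"] by (simp add: UNIV_bool sg_def)
    qed
    finally show ?thesis by (simp add: prod.distrib)
  qed
  have "2 ^ n * Expect n m T = (\<Sum>\<epsilon>\<in>?S. Expect n m T)"
    by (simp add: card_PiE)
  also have "\<dots> = (\<Sum>\<epsilon>\<in>?S. \<integral>x. T x * ?L \<epsilon> x \<partial>mvn n (\<lambda>_. 0))"
    by (rule sum.cong[OF refl E])
  also have "\<dots> = (\<integral>x. (\<Sum>\<epsilon>\<in>?S. T x * ?L \<epsilon> x) \<partial>mvn n (\<lambda>_. 0))"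
    by (rule Bochner_Integration.integral_sum[OF int, symmetric])
  also have "\<dots> = 2 ^ n * (\<integral>x. T x * (\<Prod>i<n. sign_ratio a (x i)) \<partial>mvn n (\<lambda>_. 0))"
    unfolding sum_distrib_left[symmetric] prod mult.left_commute[of _ "2 ^ n"]
    by (rule integral_mult_right_zero)
  finally show ?thesis by simp
qed

section \<open>Bounding the power deviation\<close>

text \<open>With \<open>Y = T (L - 1)\<close>, where \<open>L\<close> is the likelihood ratio of the mixture, nonnegativity of the
  variance gives \<open>(E Y)\<^sup>2 \<le> E (Y\<^sup>2) \<le> E ((L - 1)\<^sup>2) = E (L\<^sup>2) - 1\<close>, as \<open>E L = 1\<close>.\<close>

lemma power_deviation_bound:
  assumes T: "T \<in> invariant_tests n" and m: "(enorm n m)\<^sup>2 = real n * a\<^sup>2"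
  shows "\<bar>Expect n m T - Expect n (\<lambda>_. 0) T\<bar> \<le> sqrt (cosh (a\<^sup>2) ^ n - 1)"
proof -
  interpret prob_space "mvn n (\<lambda>_. 0)" by (rule prob_space_mvn)
  have T': "T \<in> test_functions n" using T by (simp add: invariant_tests_def)
  define L where "L x = (\<Prod>i<n. sign_ratio a (x i))" for x :: "nat \<Rightarrow> real"
  have L: "integrable (mvn n (\<lambda>_. 0)) L" "expectation L = 1"
    unfolding L_def
    using integrable_mvn_prod[of n "\<lambda>_. sign_ratio a"] integral_mvn_prod[of n "\<lambda>_. sign_ratio a"]
    by (simp_all add: integral_sign_ratio integrable_sign_ratio)
  have L2: "integrable (mvn n (\<lambda>_. 0)) (\<lambda>x. (L x)\<^sup>2)" "expectation (\<lambda>x. (L x)\<^sup>2) = cosh (a\<^sup>2) ^ n"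
    unfolding L_def prod_power_distrib
    using integrable_mvn_prod[of n "\<lambda>_ x. (sign_ratio a x)\<^sup>2"]
      integral_mvn_prod[of n "\<lambda>_ x. (sign_ratio a x)\<^sup>2"]
    by (simp_all add: integral_sign_ratio_sq integrable_sign_ratio_sq)
  define Y where "Y x = T x * (L x - 1)" for x
  have D: "(L x - 1)\<^sup>2 = (L x)\<^sup>2 - 2 * L x + 1" for x
    by (simp add: power2_diff)
  have D2: "integrable (mvn n (\<lambda>_. 0)) (\<lambda>x. (L x - 1)\<^sup>2)"
    unfolding D using L L2 by (intro Bochner_Integration.integrable_add Bochner_Integration.integrable_diff) auto
  have ED2: "expectation (\<lambda>x. (L x - 1)\<^sup>2) = cosh (a\<^sup>2) ^ n - 1"
    unfolding D using L L2 prob_space by simp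
  have Y: "integrable (mvn n (\<lambda>_. 0)) Y"
    unfolding Y_def using L by (intro integrable_test_mult[OF T']) auto
  have Y2: "integrable (mvn n (\<lambda>_. 0)) (\<lambda>x. (Y x)\<^sup>2)"
  proof -
    have "integrable (mvn n (\<lambda>_. 0)) (\<lambda>x. T x * (T x * (L x - 1)\<^sup>2))"
      by (intro integrable_test_mult[OF T'] D2)
    then show ?thesis by (simp add: Y_def power2_eq_square mult.left_commute mult.assoc)
  qed
  have int1: "integrable (mvn n (\<lambda>_. 0)) T"
    using integrable_test_mult[OF T', of "\<lambda>_. 0" "\<lambda>_. 1"] by simp
  have intL: "integrable (mvn n (\<lambda>_. 0)) (\<lambda>x. T x * L x)"
    by (intro integrable_test_mult[OF T'] L)
  have EY: "Expect n m T - Expect n (\<lambda>_. 0) T = expectation Y"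
    unfolding Expect_sign_average[OF T m] L_def[symmetric] Expect_def[of n "\<lambda>_. 0"] Y_def
      right_diff_distrib mult_1_right
    by (rule Bochner_Integration.integral_diff[OF intL int1, symmetric])
  have "(expectation Y)\<^sup>2 \<le> expectation (\<lambda>x. (Y x)\<^sup>2)"
    using variance_positive[of Y] variance_eq[OF Y Y2] by simp
  also have "\<dots> \<le> expectation (\<lambda>x. (L x - 1)\<^sup>2)"
  proof (rule integral_mono[OF Y2 D2])
    fix x assume "x \<in> space (mvn n (\<lambda>_. 0))"
    then have "0 \<le> T x" "T x \<le> 1" using T' by (auto simp: test_functions_def)
    then show "(Y x)\<^sup>2 \<le> (L x - 1)\<^sup>2"
      unfolding Y_def power_mult_distrib by (intro mult_left_le_one_le) (auto simp: power_le_one)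
  qed
  finally have "(expectation Y)\<^sup>2 \<le> cosh (a\<^sup>2) ^ n - 1" unfolding ED2 .
  then have "sqrt ((expectation Y)\<^sup>2) \<le> sqrt (cosh (a\<^sup>2) ^ n - 1)" by (rule real_sqrt_le_mono)
  then show ?thesis unfolding EY by simp
qed

theorem theorem1:
  fixes \<delta> :: real
  assumes "\<delta> > 0"
  shows "(\<lambda>n. Sup {\<bar>Expect n m T - Expect n (\<lambda>i\<in>{..<n}. 0) T\<bar> | T m.
           T \<in> invariant_tests n \<and> m \<in> space (Rn n) \<and> enorm n m \<le> \<delta>}) \<longlonglongrightarrow> 0"
proof (rule tendsto_sandwich[of "\<lambda>_. 0" _ _ "\<lambda>n. sqrt (cosh (\<delta>\<^sup>2 / real n) ^ n - 1)"])
  have "(\<lambda>n. ((exp (\<delta>\<^sup>2 / real n) + exp (- (\<delta>\<^sup>2 / real n))) / 2) ^ n) \<longlonglongrightarrow> 1"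
    by real_asymp
  then have "(\<lambda>n. cosh (\<delta>\<^sup>2 / real n) ^ n) \<longlonglongrightarrow> 1"
    by (simp add: cosh_def)
  then have "(\<lambda>n. sqrt (cosh (\<delta>\<^sup>2 / real n) ^ n - 1)) \<longlonglongrightarrow> sqrt (1 - 1)"
    by (intro tendsto_intros)
  then show "(\<lambda>n. sqrt (cosh (\<delta>\<^sup>2 / real n) ^ n - 1)) \<longlonglongrightarrow> 0" by simp
  show "\<forall>\<^sub>F n in sequentially. 0 \<le> Sup (power_deviations n \<delta>)"
  proof (rule always_eventually, rule allI)
    fix n
    obtain d where d: "d \<in> power_deviations n \<delta>"
      using power_deviations_nonempty[of \<delta> n] assms by fastforce
    then have "0 \<le> d" by auto
    also have "d \<le> Sup (power_deviations n \<delta>)"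
      by (rule cSup_upper[OF d bdd_above_power_deviations])
    finally show "0 \<le> Sup (power_deviations n \<delta>)" .
  qed
  show "\<forall>\<^sub>F n in sequentially. Sup (power_deviations n \<delta>) \<le> sqrt (cosh (\<delta>\<^sup>2 / real n) ^ n - 1)"
    using eventually_gt_at_top[of "0::nat"]
  proof eventually_elim
    case (elim n)
    show ?case
    proof (rule cSup_least)
      show "power_deviations n \<delta> \<noteq> {}" using assms by (intro power_deviations_nonempty) simp
      fix d assume "d \<in> power_deviations n \<delta>"
      then obtain T m where T: "T \<in> invariant_tests n" and m: "enorm n m \<le> \<delta>"
        and d: "d = \<bar>Expect n m T - Expect n (\<lambda>i\<in>{..<n}. 0) T\<bar>" by blast
      define a where "a = enorm n m / sqrt (real n)"
      have a: "a\<^sup>2 = (enorm n m)\<^sup>2 / real n" by (simp add: a_def power_divide)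
      have "Expect n (\<lambda>i\<in>{..<n}. 0) T = Expect n (\<lambda>_. 0) T" by (rule Expect_cong) simp
      then have "d \<le> sqrt (cosh (a\<^sup>2) ^ n - 1)"
        unfolding d using power_deviation_bound[OF T, of m a] a elim by simp
      also have "\<dots> \<le> sqrt (cosh (\<delta>\<^sup>2 / real n) ^ n - 1)"
      proof -
        have "a\<^sup>2 \<le> \<delta>\<^sup>2 / real n"
          unfolding a using m elim by (intro divide_right_mono power_mono enorm_nonneg) auto
        then have "cosh (a\<^sup>2) \<le> cosh (\<delta>\<^sup>2 / real n)"
          by (subst cosh_real_nonneg_le_iff) auto
        then show ?thesis by (intro real_sqrt_le_mono diff_right_mono power_mono) auto
      qed
      finally show "d \<le> sqrt (cosh (\<delta>\<^sup>2 / real n) ^ n - 1)" .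
    qed
  qed
qed simp

end
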